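(* Let $q,m,n$ be integers with $n>m$ such that one of the following holds: (a) $q=2$, $m=3$; (b) $q=3$, $m=2$; (c) $q\ge 4$, $m=1$. Then \[\sum_{k=m}^{n-1} q^{2(n-k)}\genfrac{[}{]}{0pt}{0}{n}{k}_q^2\,(q^k)!\,(q^n-q^k)!<(q^n)!.\]
   Context: $\genfrac{[}{]}{0pt}{0}{n}{k}_q=\frac{(q^n-1)(q^{n-1}-1)\cdots(q^{n-k+1}-1)}{(q^k-1)(q^{k-1}-1)\cdots(q-1)}$ is the Gaussian binomial coefficient. *)

theory Defs
  imports Complex_Main
begin

definition gauss_binomial :: "'a::field \<Rightarrow> nat \<Rightarrow> nat \<Rightarrow> 'a" where
  "gauss_binomial q n k = (\<Prod>i<k. q ^ (n - i) - 1) / (\<Prod>i=1..k. q ^ i - 1)"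

end

theory Submission
  imports Defs
begin

text \<open>Divided by \<open>(q^n)!\<close>, the \<open>k\<close>-th summand becomes \<open>q^(2(n-k)) G^2 / (q^n choose q^k)\<close>, where
  \<open>G\<close> is the Gaussian binomial. Euler's product \<open>\<Prod>(1 - x^j)\<close> is at least \<open>1 - x - x^2\<close>,
  so that \<open>G\<close> exceeds \<open>q^(k(n-k))\<close> at most by a constant factor. As \<open>(N choose K) / N^K\<close> increases
  with \<open>N\<close> and \<open>2k + 2 \<le> q^k\<close>, the resulting bound of the quotient is worst for \<open>n = k + 1\<close>, where
  \<open>(q^(k+1) choose q^k) \<ge> q^(q^k)\<close> bounds it by \<open>2^(-(k-m+1))\<close>; these bounds add up to less than \<open>1\<close>.
  Only for \<open>(q,k) = (2,3)\<close> and \<open>(4,1)\<close>, where \<open>2k + 2 = q^k\<close>, the numerical value of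
  \<open>(q^(k+1) choose q^k)\<close> is needed instead.\<close>

text \<open>The left-hand side starts the pentagonal number series; the additional term \<open>x^(k+1)\<close>
  is what makes the induction work.\<close>

lemma prod_one_minus_powers_ge:
  fixes x :: "'a::linordered_idom"
  assumes "0 \<le> x" "x \<le> 1"
  shows "1 - x - x\<^sup>2 + x ^ (k + 1) \<le> (\<Prod>j=1..k. 1 - x ^ j)"
proof (induction k)
  case 0
  then show ?case by simp
next
  case (Suc k)
  show ?case
  proof (cases "k = 0")
    case True
    then show ?thesis by (simp add: power2_eq_square)
  next
    case False
    then have "x ^ Suc k * x ^ Suc k \<le> x ^ (k + 3)"
      unfolding power_add[symmetric] using assms by (intro power_decreasing) auto
    then have "1 - x - x\<^sup>2 + x ^ (Suc k + 1) \<le> (1 - x - x\<^sup>2 + x ^ (k + 1)) * (1 - x ^ Suc k)"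
      by (simp add: algebra_simps power2_eq_square power3_eq_cube power_add)
    also have "\<dots> \<le> (\<Prod>j=1..k. 1 - x ^ j) * (1 - x ^ Suc k)"
      using Suc.IH assms by (intro mult_right_mono) (auto intro: power_le_one simp del: power_Suc)
    finally show ?thesis by simp
  qed
qed

lemma gauss_binomial_altdef:
  assumes "k \<le> n"
  shows "gauss_binomial q n k = (\<Prod>j=1..k. (q ^ (n - k + j) - 1) / (q ^ j - 1))"
proof -
  have "(\<Prod>i<k. q ^ (n - i) - 1) = (\<Prod>j=1..k. q ^ (n - k + j) - 1)"
    using assms by (intro prod.reindex_bij_witness[of _ "\<lambda>j. k - j" "\<lambda>i. k - i"]) auto
  then show ?thesis by (simp add: gauss_binomial_def prod_dividef)
qed

lemma gauss_binomial_nonneg: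
  fixes q :: "'a::linordered_field"
  assumes "1 \<le> q"
  shows "0 \<le> gauss_binomial q n k"
  unfolding gauss_binomial_def using assms
  by (intro divide_nonneg_nonneg prod_nonneg) auto

lemma gauss_binomial_le_prod:
  fixes q :: "'a::linordered_field"
  assumes "1 < q" "k \<le> n"
  shows "gauss_binomial q n k \<le> q ^ (k * (n - k)) / (\<Prod>j=1..k. 1 - (1 / q) ^ j)"
proof -
  have "gauss_binomial q n k \<le> (\<Prod>j=1..k. q ^ (n - k) / (1 - (1 / q) ^ j))"
    unfolding gauss_binomial_altdef[OF assms(2)]
  proof (rule prod_mono)
    fix j assume "j \<in> {1..k}"
    then have "1 < q ^ j" "1 \<le> q ^ (n - k + j)"
      using assms(1) by (auto intro: one_less_power one_le_power)
    moreover from this assms(1) have "q ^ (n - k) / (1 - (1 / q) ^ j) = q ^ (n - k + j) / (q ^ j - 1)"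
      by (simp add: field_simps power_add)
    ultimately show "0 \<le> (q ^ (n - k + j) - 1) / (q ^ j - 1) \<and>
        (q ^ (n - k + j) - 1) / (q ^ j - 1) \<le> q ^ (n - k) / (1 - (1 / q) ^ j)"
      by (simp add: divide_right_mono)
  qed
  also have "\<dots> = q ^ (k * (n - k)) / (\<Prod>j=1..k. 1 - (1 / q) ^ j)"
    by (simp add: prod_dividef mult.commute flip: power_mult)
  finally show ?thesis .
qed

lemma gauss_binomial_le:
  fixes q \<delta> :: "'a::linordered_field"
  assumes "1 < q" "k \<le> n" "0 < \<delta>" "\<delta> \<le> 1 - 1 / q - (1 / q)\<^sup>2"
  shows "gauss_binomial q n k \<le> q ^ (k * (n - k)) / \<delta>"
proof -
  have "\<delta> \<le> 1 - 1 / q - (1 / q)\<^sup>2 + (1 / q) ^ (k + 1)"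
    using assms by (simp add: add_increasing2)
  also have "\<dots> \<le> (\<Prod>j=1..k. 1 - (1 / q) ^ j)"
    using assms(1) by (intro prod_one_minus_powers_ge) auto
  finally have "q ^ (k * (n - k)) / (\<Prod>j=1..k. 1 - (1 / q) ^ j) \<le> q ^ (k * (n - k)) / \<delta>"
    using assms by (intro frac_le) auto
  with gauss_binomial_le_prod[OF assms(1,2)] show ?thesis by (rule order_trans)
qed

lemma binomial_mult_power_le:
  assumes "M \<le> N"
  shows "(M choose K) * N ^ K \<le> (N choose K) * M ^ K"
proof (induction K)
  case 0
  then show ?case by simp
next
  case (Suc K)
  have Suc_times_choose_power:
    "Suc K * ((L choose Suc K) * P ^ Suc K) = ((L - K) * P) * ((L choose K) * P ^ K)" for L P
  proof -
    have "Suc K * (L choose Suc K) = (L - K) * (L choose K)"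
      by (metis binomial_absorb_comp binomial_absorption mult.commute)
    then have "Suc K * (L choose Suc K) * P ^ Suc K = (L - K) * (L choose K) * P ^ Suc K"
      by (rule arg_cong)
    then show ?thesis by (simp only: power_Suc mult_ac)
  qed
  have "(M - K) * N = M * N - K * N" by (rule diff_mult_distrib)
  also have "\<dots> \<le> N * M - K * M" using assms by (simp add: mult.commute diff_le_mono2)
  also have "\<dots> = (N - K) * M" by (rule diff_mult_distrib[symmetric])
  finally have "(M - K) * N \<le> (N - K) * M" .
  then have "((M - K) * N) * ((M choose K) * N ^ K) \<le> ((N - K) * M) * ((N choose K) * M ^ K)"
    using Suc.IH by (rule mult_le_mono)
  then have "Suc K * ((M choose Suc K) * N ^ Suc K) \<le> Suc K * ((N choose Suc K) * M ^ Suc K)"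
    by (simp only: Suc_times_choose_power)
  then show ?case by (simp only: mult_le_cancel1)
qed

lemma binomial_mult_power_le_binomial_mult:
  assumes "0 < M" "1 \<le> c"
  shows "(M choose K) * c ^ K \<le> (M * c choose K)"
proof -
  have "(M choose K) * (M * c) ^ K \<le> (M * c choose K) * M ^ K"
    using assms by (intro binomial_mult_power_le) simp
  then show ?thesis using assms(1) by (simp add: power_mult_distrib)
qed

definition gauss_ratio :: "nat \<Rightarrow> nat \<Rightarrow> nat \<Rightarrow> real" where
  "gauss_ratio q n k =
    real q ^ (2 * (n - k)) * (gauss_binomial (real q) n k)\<^sup>2 / real (q ^ n choose q ^ k)"

lemma gauss_ratio_mult_fact:
  assumes "1 \<le> q" "k \<le> n"
  shows "gauss_ratio q n k * fact (q ^ n) =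
    real q ^ (2 * (n - k)) * (gauss_binomial (real q) n k)\<^sup>2 * fact (q ^ k) * fact (q ^ n - q ^ k)"
  using power_increasing[OF assms(2,1)] by (simp add: gauss_ratio_def binomial_fact)

lemma gauss_ratio_le:
  fixes \<delta> :: real
  assumes "2 \<le> q" "k < n" "2 * k + 2 \<le> q ^ k"
    and "0 < \<delta>" "\<delta> \<le> 1 - 1 / real q - (1 / real q)\<^sup>2"
  shows "gauss_ratio q n k \<le> (real q ^ (k + 1) / \<delta>)\<^sup>2 / real (q ^ (k + 1) choose q ^ k)"
proof -
  define d where "d = n - Suc k"
  have n: "n = k + 1 + d" using assms(2) by (simp add: d_def)
  define B where "B = (q ^ (k + 1) choose q ^ k)"
  have "0 < B" unfolding B_def using assms(1) by (simp add: zero_less_binomial_iff)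
  have "gauss_binomial (real q) n k \<le> real q ^ (k * (n - k)) / \<delta>"
    using assms by (intro gauss_binomial_le) auto
  then have "(gauss_binomial (real q) n k)\<^sup>2 \<le> (real q ^ (k * (n - k)) / \<delta>)\<^sup>2"
    using assms(1) by (intro power_mono gauss_binomial_nonneg) auto
  then have "real q ^ (2 * (n - k)) * (gauss_binomial (real q) n k)\<^sup>2
      \<le> real q ^ (2 * (n - k)) * (real q ^ (k * (n - k)) / \<delta>)\<^sup>2"
    by (intro mult_left_mono) auto
  also have "\<dots> = (real q ^ (k + 1) / \<delta>)\<^sup>2 * real q ^ (d * (2 * k + 2))"
    by (simp add: n power_divide algebra_simps flip: power_add power_mult)
  finally have numerator: "real q ^ (2 * (n - k)) * (gauss_binomial (real q) n k)\<^sup>2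
      \<le> (real q ^ (k + 1) / \<delta>)\<^sup>2 * real q ^ (d * (2 * k + 2))" .
  have "q ^ (d * (2 * k + 2)) \<le> q ^ (d * q ^ k)"
    using assms(1,3) by (intro power_increasing mult_le_mono2) auto
  then have "B * q ^ (d * (2 * k + 2)) \<le> B * (q ^ d) ^ (q ^ k)"
    by (simp flip: power_mult)
  also have "\<dots> \<le> (q ^ (k + 1) * q ^ d choose q ^ k)"
    unfolding B_def using assms(1) by (intro binomial_mult_power_le_binomial_mult) auto
  also have "q ^ (k + 1) * q ^ d = q ^ n" by (simp add: n power_add)
  finally have "B * q ^ (d * (2 * k + 2)) \<le> (q ^ n choose q ^ k)" .
  then have denominator: "real B * real q ^ (d * (2 * k + 2)) \<le> real (q ^ n choose q ^ k)"
    by (metis of_nat_le_iff of_nat_mult of_nat_power)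
  have "gauss_ratio q n k \<le> (real q ^ (k + 1) / \<delta>)\<^sup>2 * real q ^ (d * (2 * k + 2))
      / (real B * real q ^ (d * (2 * k + 2)))"
    unfolding gauss_ratio_def using numerator denominator \<open>0 < B\<close> assms(1)
    by (intro frac_le) auto
  also have "\<dots> = (real q ^ (k + 1) / \<delta>)\<^sup>2 / real B" using assms(1) by simp
  finally show ?thesis unfolding B_def .
qed

lemma gauss_ratio_le_half_power:
  fixes \<delta> :: real
  assumes "2 \<le> q" "k < n" "2 * k + 2 + s \<le> q ^ k"
    and "0 < \<delta>" "\<delta> \<le> 1 - 1 / real q - (1 / real q)\<^sup>2"
    and "2 ^ r \<le> \<delta>\<^sup>2 * real q ^ s"
  shows "gauss_ratio q n k \<le> (1 / 2) ^ r"
proof -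
  have "real q ^ (2 * k + 2 + s) \<le> real q ^ (q ^ k)"
    using assms(1,3) by (intro power_increasing) auto
  also have "\<dots> \<le> real (q ^ (k + 1) choose q ^ k)"
    using assms(1) binomial_ge_n_over_k_pow_k[of "q ^ k" "q ^ (k + 1)", where 'a = real] by simp
  finally have binomial_ge: "real q ^ (2 * k + 2 + s) \<le> real (q ^ (k + 1) choose q ^ k)" .
  have "gauss_ratio q n k \<le> (real q ^ (k + 1) / \<delta>)\<^sup>2 / real (q ^ (k + 1) choose q ^ k)"
    using assms by (intro gauss_ratio_le) auto
  also have "\<dots> \<le> (real q ^ (k + 1) / \<delta>)\<^sup>2 / real q ^ (2 * k + 2 + s)"
    using binomial_ge assms(1) by (intro divide_left_mono) auto
  also have "\<dots> = 1 / (\<delta>\<^sup>2 * real q ^ s)"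
    using assms(1,4) by (simp add: field_simps power_add power_mult power2_eq_square)
  also have "\<dots> \<le> 1 / 2 ^ r"
    using assms(6) by (intro frac_le) auto
  finally show ?thesis by (simp add: power_one_over)
qed

lemma gauss_ratio_2_le:
  assumes "3 \<le> k" "k < n"
  shows "gauss_ratio 2 n k \<le> (1 / 2) ^ (k - 2)"
proof (cases "k = 3")
  case True
  have "((16::nat) choose 8) = 12870" by (simp add: binomial_fact' fact_numeral)
  then show ?thesis
    using gauss_ratio_le[of 2 3 n "1 / 4"] assms True by (simp add: power2_eq_square)
next
  case False
  then have "4 \<le> k" using assms(1) by simp
  show ?thesis
  proof (rule gauss_ratio_le_half_power)
    show "2 * k + 2 + (k + 2) \<le> 2 ^ k"
      using \<open>4 \<le> k\<close> by (induction k rule: dec_induct) auto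
    have "k + 2 = (k - 2) + 4" using \<open>4 \<le> k\<close> by simp
    then have "(2::real) ^ (k + 2) = 2 ^ (k - 2) * 2 ^ 4" by (metis power_add)
    then show "2 ^ (k - 2) \<le> (1 / 4)\<^sup>2 * real 2 ^ (k + 2)" by (simp add: power2_eq_square)
  qed (use assms in \<open>auto simp: power2_eq_square\<close>)
qed

lemma three_mult_add_two_le_power:
  fixes q k :: nat
  assumes "3 \<le> q" "2 \<le> k"
  shows "3 * k + 2 \<le> q ^ k"
proof -
  have "3 * k + 2 \<le> 3 ^ k" using assms(2) by (induction k rule: dec_induct) auto
  also have "\<dots> \<le> q ^ k" using assms(1) by (intro power_mono) auto
  finally show ?thesis .
qed

lemma gauss_ratio_3_le:
  assumes "2 \<le> k" "k < n"
  shows "gauss_ratio 3 n k \<le> (1 / 2) ^ (k - 1)"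
proof (rule gauss_ratio_le_half_power)
  show "2 * k + 2 + k \<le> 3 ^ k" using three_mult_add_two_le_power[of 3 k] assms(1) by simp
  have "4 * 2 ^ (k - 1) \<le> (3::real) ^ k"
    using assms(1)
  proof (induction k rule: dec_induct)
    case (step k)
    then have "4 * 2 ^ (Suc k - 1) = 2 * (4 * (2::real) ^ (k - 1))" by (cases k) auto
    also have "\<dots> \<le> 2 * 3 ^ k" using step.IH by simp
    also have "\<dots> \<le> 3 ^ Suc k" by simp
    finally show ?case .
  qed simp
  then show "2 ^ (k - 1) \<le> (1 / 2)\<^sup>2 * real 3 ^ k" by (simp add: power2_eq_square)
qed (use assms in \<open>auto simp: power2_eq_square\<close>)

lemma gauss_ratio_ge_4_le:
  assumes "4 \<le> q" "1 \<le> k" "k < n"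
  shows "gauss_ratio q n k \<le> (1 / 2) ^ k"
proof (cases "q = 4 \<and> k = 1")
  case True
  have "((16::nat) choose 4) = 1820" by (simp add: binomial_fact' fact_numeral)
  then show ?thesis
    using gauss_ratio_le[of 4 1 n "2 / 3"] assms True by (simp add: power2_eq_square)
next
  case False
  then consider "k = 1" "5 \<le> q" | "2 \<le> k" using assms by linarith
  then have "3 * k + 2 \<le> q ^ k \<and> 9 * 2 ^ k \<le> 4 * real q ^ k"
  proof cases
    case 1
    then show ?thesis by simp
  next
    case 2
    have "(2::real) ^ 2 \<le> 2 ^ k" using 2 by (intro power_increasing) auto
    then have "9 * 2 ^ k \<le> 4 * 2 ^ k * (2::real) ^ k" by (intro mult_right_mono) auto
    also have "\<dots> = 4 * 4 ^ k" by (simp flip: power_mult_distrib)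
    also have "\<dots> \<le> 4 * real q ^ k" using assms(1) by (intro mult_left_mono power_mono) auto
    finally show ?thesis using three_mult_add_two_le_power 2 assms(1) by simp
  qed
  moreover have "2 / 3 \<le> 1 - 1 / real q - (1 / real q)\<^sup>2"
  proof -
    have "1 / real q \<le> 1 / 4" using assms(1) by simp
    moreover from this have "(1 / real q)\<^sup>2 \<le> (1 / 4)\<^sup>2" by (intro power_mono) auto
    ultimately show ?thesis by (simp add: power2_eq_square)
  qed
  ultimately show ?thesis
    using assms by (intro gauss_ratio_le_half_power[where \<delta> = "2 / 3" and s = k])
      (auto simp: power2_eq_square)
qed

lemma sum_half_powers:
  assumes "m \<le> n"
  shows "(\<Sum>k=m..<n. (1 / 2 :: 'a::field_char_0) ^ (k + 1 - m)) = 1 - (1 / 2) ^ (n - m)"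
  using assms by (induction n rule: dec_induct) (auto simp: Suc_diff_le)

theorem theorem2p3:
  fixes q m n :: nat
  assumes "m < n"
    and "(q = 2 \<and> m = 3) \<or> (q = 3 \<and> m = 2) \<or> (q \<ge> 4 \<and> m = 1)"
  shows "(\<Sum>k=m..n-1. real q ^ (2 * (n - k)) * (gauss_binomial (real q) n k)\<^sup>2
            * fact (q ^ k) * fact (q ^ n - q ^ k)) < (fact (q ^ n) :: real)"
proof -
  have interval: "{m..n-1} = {m..<n}" using assms(1) by auto
  have "gauss_ratio q n k \<le> (1 / 2) ^ (k + 1 - m)" if "k \<in> {m..<n}" for k
    using assms(2) that gauss_ratio_2_le[of k n] gauss_ratio_3_le[of k n]
      gauss_ratio_ge_4_le[of q k n]
    by (auto simp: numeral_eq_Suc)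
  then have "(\<Sum>k=m..<n. gauss_ratio q n k) \<le> (\<Sum>k=m..<n. (1 / 2) ^ (k + 1 - m))"
    by (rule sum_mono)
  also have "\<dots> < 1" using assms(1) by (subst sum_half_powers) auto
  finally have "(\<Sum>k=m..<n. gauss_ratio q n k) * fact (q ^ n) < 1 * fact (q ^ n)"
    by (intro mult_strict_right_mono) auto
  moreover have "(\<Sum>k=m..n-1. real q ^ (2 * (n - k)) * (gauss_binomial (real q) n k)\<^sup>2
      * fact (q ^ k) * fact (q ^ n - q ^ k)) = (\<Sum>k=m..<n. gauss_ratio q n k) * fact (q ^ n)"
    unfolding interval sum_distrib_right
    using assms(2) by (intro sum.cong gauss_ratio_mult_fact[symmetric]) auto
  ultimately show ?thesis by simp
qed

end
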